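(* Let $G=(V,E)$ be a finite simple graph and let $A,B\subseteq V$ be two vertex subsets. Then \[ \Delta(G,A,B)=\sigma(G_{-A})\cdot\sigma(G_{-B})-\sigma(G)\cdot\sigma(G_{-A-B}) \] satisfies: $\Delta(G,A,B)<0$ if $P_i(G,A,B)$ is even; $\Delta(G,A,B)=0$ if $P_i(G,A,B)$ is infinite; and $\Delta(G,A,B)>0$ if $P_i(G,A,B)$ is odd.
   Context: For a finite simple graph $H$, $\sigma(H)$ denotes the number of independent vertex sets of $H$ (subsets of vertices no two of which are adjacent), including the empty set; the graph with no vertices has $\sigma=1$. For a vertex subset $X$, $H_{-X}$ is the graph obtained from $H$ by deleting all vertices of $X$ together with their incident edges; $H_{-X-Y}$ means $H_{-(X\cup Y)}$. A path $P=(v_1,\dots,v_k)$ ($k\ge 1$) of $G$ is an induced $A$-$B$-path if $V(P)\cap A=\{v_1\}$, $V(P)\cap B=\{v_k\}$, and for all $i,j$: $\{v_i,v_j\}\in E$ if and only if $|i-j|=1$. Its length is $k-1$ (the number of edges). $P_i(G,A,B)$ denotes the set of all induced $A$-$B$-paths in $G$. $P_i(G,A,B)$ is called infinite if it is empty (there is no induced $A$-$B$-path); it is called even (resp. odd) if it is nonempty and every path in it has even (resp. odd) length. *)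

theory Defs
  imports Main
begin

record 'a graph =
  verts :: "'a set"
  edges :: "'a set set"

definition finite_simple_graph :: "'a graph \<Rightarrow> bool" where
  "finite_simple_graph G \<longleftrightarrow>
     finite (verts G) \<and>
     edges G \<subseteq> {{u, v} | u v. u \<in> verts G \<and> v \<in> verts G \<and> u \<noteq> v}"

definition delete_verts :: "'a graph \<Rightarrow> 'a set \<Rightarrow> 'a graph" where
  "delete_verts G X =
     \<lparr>verts = verts G - X, edges = {e \<in> edges G. e \<inter> X = {}}\<rparr>"

definition independent_set :: "'a graph \<Rightarrow> 'a set \<Rightarrow> bool" where
  "independent_set G S \<longleftrightarrow>
     S \<subseteq> verts G \<and> (\<forall>u\<in>S. \<forall>v\<in>S. {u, v} \<notin> edges G)"

definition num_independent_sets :: "'a graph \<Rightarrow> nat" where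
  "num_independent_sets G = card {S. independent_set G S}"

text \<open>A path is the nonempty list of its pairwise distinct vertices. Distinctness has to be
  required separately: it does not follow from the condition on the edges in
  \<open>induced_AB_path\<close>, which for instance the list \<open>[a, b, a]\<close> satisfies
  whenever \<open>{a, b}\<close> is an edge.\<close>

definition path :: "'a graph \<Rightarrow> 'a list \<Rightarrow> bool" where
  "path G p \<longleftrightarrow>
     p \<noteq> [] \<and> distinct p \<and> set p \<subseteq> verts G \<and>
     (\<forall>i. Suc i < length p \<longrightarrow> {p ! i, p ! Suc i} \<in> edges G)"

definition path_length :: "'a list \<Rightarrow> nat" where
  "path_length p = length p - 1"

definition induced_AB_path :: "'a graph \<Rightarrow> 'a set \<Rightarrow> 'a set \<Rightarrow> 'a list \<Rightarrow> bool" where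
  "induced_AB_path G A B p \<longleftrightarrow>
     path G p \<and>
     set p \<inter> A = {hd p} \<and> set p \<inter> B = {last p} \<and>
     (\<forall>i < length p. \<forall>j < length p.
        {p ! i, p ! j} \<in> edges G \<longleftrightarrow> \<bar>int i - int j\<bar> = 1)"

definition induced_AB_paths :: "'a graph \<Rightarrow> 'a set \<Rightarrow> 'a set \<Rightarrow> 'a list set" where
  "induced_AB_paths G A B = {p. induced_AB_path G A B p}"

text \<open>``Infinite'' is the name for the absence of any such path; it does not refer to the
  cardinality of the set.\<close>

definition paths_infinite :: "'a list set \<Rightarrow> bool" where
  "paths_infinite P \<longleftrightarrow> P = {}"

definition paths_even :: "'a list set \<Rightarrow> bool" where
  "paths_even P \<longleftrightarrow> P \<noteq> {} \<and> (\<forall>p\<in>P. even (path_length p))"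

definition paths_odd :: "'a list set \<Rightarrow> bool" where
  "paths_odd P \<longleftrightarrow> P \<noteq> {} \<and> (\<forall>p\<in>P. odd (path_length p))"

definition Delta :: "'a graph \<Rightarrow> 'a set \<Rightarrow> 'a set \<Rightarrow> int" where
  "Delta G A B =
     int (num_independent_sets (delete_verts G A)) * int (num_independent_sets (delete_verts G B))
     - int (num_independent_sets G) * int (num_independent_sets (delete_verts G (A \<union> B)))"

end

theory Submission
  imports Defs
begin

text \<open>Both products in \<open>\<Delta>\<close> count pairs \<open>(S, T)\<close> of independent sets of \<open>G\<close>: in the
  first, \<open>S\<close> avoids \<open>A\<close> and \<open>T\<close> avoids \<open>B\<close>; in the second, \<open>T\<close> avoids \<open>A \<union> B\<close>. The graph induced
  on the symmetric difference \<open>D\<close> of \<open>S\<close> and \<open>T\<close> is bipartite, and exchanging \<open>S\<close> and \<open>T\<close> on a union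
  of its components preserves independence and \<open>D\<close>. If no component meets both \<open>A\<close> and
  \<open>B\<close>, exchanging on the components that meet \<open>A\<close> matches pairs of the two kinds. In the
  remaining pairs a shortest path in \<open>D\<close> from \<open>A\<close> to \<open>B\<close> is an induced \<open>A\<close>-\<open>B\<close>-path alternating
  between \<open>S\<close> and \<open>T\<close>; it has odd length for pairs of the first kind and even length for
  pairs of the second kind. Conversely the two colour classes of an induced \<open>A\<close>-\<open>B\<close>-path form a
  remaining pair of the kind determined by its parity.\<close>

text \<open>Vertices may repeat, so walks can be concatenated freely; distinctness is recovered
  later by taking a shortest walk.\<close>

definition walk_in :: "'a graph \<Rightarrow> 'a set \<Rightarrow> 'a list \<Rightarrow> bool" where
  "walk_in G D p \<longleftrightarrow> p \<noteq> [] \<and> set p \<subseteq> D \<and> successively (\<lambda>u v. {u, v} \<in> edges G) p"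

text \<open>The union of those components of the subgraph induced on \<open>D\<close> that meet
  \<open>A\<close>.\<close>

definition reach :: "'a graph \<Rightarrow> 'a set \<Rightarrow> 'a set \<Rightarrow> 'a set" where
  "reach G A D = {last p | p. walk_in G D p \<and> hd p \<in> A}"

definition indep_pairs :: "'a graph \<Rightarrow> 'a set \<Rightarrow> 'a set \<Rightarrow> ('a set \<times> 'a set) set" where
  "indep_pairs G X Y =
     {(S, T). independent_set G S \<and> independent_set G T \<and> S \<inter> X = {} \<and> T \<inter> Y = {}}"

definition sym_diff_pair :: "'a set \<times> 'a set \<Rightarrow> 'a set" where
  "sym_diff_pair P = (fst P - snd P) \<union> (snd P - fst P)"

definition swap_on :: "'a set \<Rightarrow> 'a set \<times> 'a set \<Rightarrow> 'a set \<times> 'a set" where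
  "swap_on W P = ((fst P - W) \<union> (snd P \<inter> W), (snd P - W) \<union> (fst P \<inter> W))"

text \<open>Some component of the symmetric difference meets both \<open>A\<close> and
  \<open>B\<close>.\<close>

definition linking :: "'a graph \<Rightarrow> 'a set \<Rightarrow> 'a set \<Rightarrow> ('a set \<times> 'a set) set" where
  "linking G A B = {P. reach G A (sym_diff_pair P) \<inter> B \<noteq> {}}"

section \<open>Walks and shortest walks inside a vertex set\<close>

lemma walk_in_edge:
  "walk_in G D p \<Longrightarrow> Suc i < length p \<Longrightarrow> {p ! i, p ! Suc i} \<in> edges G"
  by (auto simp: walk_in_def successively_conv_nth)

lemma walk_in_drop: "walk_in G D p \<Longrightarrow> i < length p \<Longrightarrow> walk_in G D (drop i p)"
  by (auto simp: walk_in_def successively_conv_nth dest: in_set_dropD)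

lemma walk_in_take: "walk_in G D p \<Longrightarrow> 0 < i \<Longrightarrow> walk_in G D (take i p)"
  by (auto simp: walk_in_def successively_conv_nth dest: in_set_takeD)

lemma walk_in_append:
  "walk_in G D p \<Longrightarrow> walk_in G D q \<Longrightarrow> {last p, hd q} \<in> edges G \<Longrightarrow> walk_in G D (p @ q)"
  by (auto simp: walk_in_def successively_append_iff)

lemma reach_subset: "reach G A D \<subseteq> D"
  by (auto simp: reach_def walk_in_def)

lemma reachI: "walk_in G D p \<Longrightarrow> hd p \<in> A \<Longrightarrow> last p \<in> reach G A D"
  by (auto simp: reach_def)

lemma subset_reach: "A \<inter> D \<subseteq> reach G A D"
proof
  fix a assume "a \<in> A \<inter> D"
  then show "a \<in> reach G A D" using reachI[of G D "[a]" A] by (simp add: walk_in_def)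
qed

lemma reach_closed:
  assumes "u \<in> reach G A D" "v \<in> D" "{u, v} \<in> edges G"
  shows "v \<in> reach G A D"
proof -
  obtain p where p: "walk_in G D p" "hd p \<in> A" "last p = u"
    using assms(1) by (auto simp: reach_def)
  have "walk_in G D (p @ [v])"
    using p assms by (intro walk_in_append) (auto simp: walk_in_def)
  moreover have "hd (p @ [v]) \<in> A" using p by (auto simp: walk_in_def)
  ultimately show ?thesis using reachI[of G D "p @ [v]" A] by simp
qed

text \<open>A shortest walk in \<open>D\<close> from \<open>A\<close> to \<open>B\<close> works: a
  further vertex in \<open>A\<close> or \<open>B\<close>, a chord or a repeated vertex would each
  yield a shorter one.\<close>

lemma exists_induced_AB_path:
  assumes G: "finite_simple_graph G" and D: "D \<subseteq> verts G"
    and meet: "reach G A D \<inter> B \<noteq> {}"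
  obtains p where "induced_AB_path G A B p" "walk_in G D p"
proof -
  define Q where "Q p \<longleftrightarrow> walk_in G D p \<and> hd p \<in> A \<and> last p \<in> B" for p
  obtain p0 where "Q p0" using meet by (auto simp: reach_def Q_def)
  then obtain p where p: "Q p" and min: "\<And>q. Q q \<Longrightarrow> length p \<le> length q"
    using ex_has_least_nat[of Q p0 length] by blast
  have w: "walk_in G D p" and ne: "p \<noteq> []" using p by (auto simp: Q_def walk_in_def)
  have inA: "i = 0" if "i < length p" "p ! i \<in> A" for i
  proof -
    have "Q (drop i p)"
      using that p walk_in_drop[OF w] by (auto simp: Q_def hd_drop_conv_nth)
    from min[OF this] that show ?thesis by auto
  qed
  have inB: "Suc i = length p" if "i < length p" "p ! i \<in> B" for i
  proof -
    have "last (take (Suc i) p) = p ! i" using that by (simp add: take_Suc_conv_app_nth)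
    then have "Q (take (Suc i) p)"
      using that p walk_in_take[OF w] by (auto simp: Q_def)
    from min[OF this] that show ?thesis by auto
  qed
  \<comment> \<open>The edge bypasses the vertices strictly between positions \<open>i\<close> and
    \<open>j\<close>, so minimality leaves none there.\<close>
  have chord: "j = Suc i" if "i < j" "j < length p" "{p ! i, p ! j} \<in> edges G" for i j
  proof -
    have l: "last (take (Suc i) p) = p ! i" using that by (simp add: take_Suc_conv_app_nth)
    have "walk_in G D (take (Suc i) p @ drop j p)"
      using that l by (intro walk_in_append walk_in_take walk_in_drop w) (auto simp: hd_drop_conv_nth)
    moreover have "hd (take (Suc i) p @ drop j p) = hd p" using ne by (simp add: hd_append)
    ultimately have "Q (take (Suc i) p @ drop j p)"
      using that p by (auto simp: Q_def)
    from min[OF this] that show ?thesis by auto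
  qed
  \<comment> \<open>If \<open>i = 0\<close>, a repetition puts a later vertex in \<open>A\<close>;
    otherwise the predecessor of \<open>p ! i\<close> is adjacent to \<open>p ! j\<close>, which
    \<open>chord\<close> excludes.\<close>
  have neq: "p ! i \<noteq> p ! j" if "i < j" "j < length p" for i j
  proof
    assume eq: "p ! i = p ! j"
    show False
    proof (cases i)
      case 0
      then have "p ! j \<in> A" using p eq ne by (simp add: Q_def hd_conv_nth)
      with inA that show False by blast
    next
      case (Suc k)
      then have "{p ! k, p ! j} \<in> edges G" using walk_in_edge[OF w, of k] eq that by auto
      from chord[OF _ _ this] Suc that show False by auto
    qed
  qed
  have dist: "distinct p"
    unfolding distinct_conv_nth using neq by (metis linorder_neqE_nat)
  \<comment> \<open>For \<open>i = j\<close> the set \<open>{p ! i, p ! j}\<close> collapses to a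
    singleton, which is never an edge.\<close>
  have loop: "{v} \<notin> edges G" for v
    using G unfolding finite_simple_graph_def by fastforce
  have le: "{p ! i, p ! j} \<in> edges G \<longleftrightarrow> j = Suc i" if "i \<le> j" "j < length p" for i j
    using that chord[of i j] walk_in_edge[OF w, of i] loop by (cases "i = j") auto
  have "{p ! i, p ! j} \<in> edges G \<longleftrightarrow> \<bar>int i - int j\<bar> = 1"
    if "i < length p" "j < length p" for i j
  proof (cases "i \<le> j")
    case True
    with le[of i j] that show ?thesis by auto
  next
    case False
    with le[of j i] that show ?thesis by (auto simp: insert_commute)
  qed
  moreover have "set p \<inter> A = {hd p}"
    using p ne inA by (fastforce simp: Q_def in_set_conv_nth hd_conv_nth)
  moreover have "set p \<inter> B = {last p}"
  proof -
    have "x = last p" if "x \<in> set p" "x \<in> B" for x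
      using that inB by (metis in_set_conv_nth last_conv_nth diff_Suc_1 ne)
    then show ?thesis using p ne by (auto simp: Q_def)
  qed
  moreover have "path G p"
    using w ne dist D walk_in_edge[OF w] by (auto simp: path_def walk_in_def)
  ultimately have "induced_AB_path G A B p" by (simp add: induced_AB_path_def)
  with w that show ?thesis by blast
qed

section \<open>From linked pairs to induced paths of known parity\<close>

lemma alternating:
  assumes "independent_set G S" "independent_set G T"
    and w: "walk_in G (sym_diff_pair (S, T)) p" and "i < length p"
  shows "p ! i \<in> S \<longleftrightarrow> (hd p \<in> S \<longleftrightarrow> even i)"
  using \<open>i < length p\<close>
proof (induction i)
  case 0
  then show ?case by (simp add: hd_conv_nth)
next
  case (Suc i)
  have e: "{p ! i, p ! Suc i} \<in> edges G" using walk_in_edge[OF w Suc.prems] .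
  \<comment> \<open>Each of the two vertices lies in exactly one of \<open>S\<close> and
    \<open>T\<close>, and independence keeps adjacent vertices out of the same one.\<close>
  have "p ! i \<in> sym_diff_pair (S, T)" "p ! Suc i \<in> sym_diff_pair (S, T)"
    using w Suc.prems by (auto simp: walk_in_def subset_iff)
  with e assms(1,2) have "p ! Suc i \<in> S \<longleftrightarrow> p ! i \<notin> S"
    by (auto simp: independent_set_def sym_diff_pair_def)
  with Suc show ?case by auto
qed

lemma linking_imp_induced_path:
  assumes "finite_simple_graph G" "independent_set G S" "independent_set G T"
    and "(S, T) \<in> linking G A B"
  obtains p where "induced_AB_path G A B p" "hd p \<in> A \<inter> sym_diff_pair (S, T)"
    "last p \<in> B \<inter> sym_diff_pair (S, T)"
    "even (path_length p) \<longleftrightarrow> (hd p \<in> S \<longleftrightarrow> last p \<in> S)"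
proof -
  let ?D = "sym_diff_pair (S, T)"
  have "?D \<subseteq> verts G"
    using assms by (auto simp: sym_diff_pair_def independent_set_def)
  moreover have "reach G A ?D \<inter> B \<noteq> {}" using assms by (simp add: linking_def)
  ultimately obtain p where p: "induced_AB_path G A B p" "walk_in G ?D p"
    using exists_induced_AB_path[OF assms(1)] by metis
  then have ne: "p \<noteq> []" by (simp add: walk_in_def)
  have "even (path_length p) \<longleftrightarrow> (hd p \<in> S \<longleftrightarrow> last p \<in> S)"
    using alternating[OF assms(2,3) p(2), of "length p - 1"] ne
    by (auto simp: path_length_def last_conv_nth)
  moreover have "hd p \<in> A" "last p \<in> B"
    using p(1) by (auto simp: induced_AB_path_def)
  moreover have "hd p \<in> ?D" "last p \<in> ?D" using p(2) ne by (auto simp: walk_in_def)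
  ultimately show ?thesis using that p(1) by blast
qed

text \<open>\<open>S\<close> avoids \<open>A\<close> and \<open>T\<close> avoids \<open>B\<close>,
  so the alternating path starts in \<open>T\<close> and ends in \<open>S\<close>.\<close>

lemma linking_odd:
  assumes "finite_simple_graph G" and P: "(S, T) \<in> indep_pairs G A B" "(S, T) \<in> linking G A B"
  shows "\<exists>p \<in> induced_AB_paths G A B. odd (path_length p)"
proof -
  have ST: "independent_set G S" "independent_set G T" "S \<inter> A = {}" "T \<inter> B = {}"
    using P by (auto simp: indep_pairs_def)
  obtain p where p: "induced_AB_path G A B p" "hd p \<in> A \<inter> sym_diff_pair (S, T)"
    "last p \<in> B \<inter> sym_diff_pair (S, T)"
    "even (path_length p) \<longleftrightarrow> (hd p \<in> S \<longleftrightarrow> last p \<in> S)"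
    using linking_imp_induced_path[OF assms(1) ST(1,2) P(2)] .
  have "hd p \<notin> S" "last p \<in> S" using ST(3,4) p(2,3) by (auto simp: sym_diff_pair_def)
  with p(1,4) show ?thesis by (auto simp: induced_AB_paths_def)
qed

text \<open>\<open>T\<close> avoids both \<open>A\<close> and \<open>B\<close>, so the alternating
  path has both ends in \<open>S\<close>.\<close>

lemma linking_even:
  assumes "finite_simple_graph G"
    and P: "(S, T) \<in> indep_pairs G {} (A \<union> B)" "(S, T) \<in> linking G A B"
  shows "\<exists>p \<in> induced_AB_paths G A B. even (path_length p)"
proof -
  have ST: "independent_set G S" "independent_set G T" "T \<inter> A = {}" "T \<inter> B = {}"
    using P by (auto simp: indep_pairs_def)
  obtain p where p: "induced_AB_path G A B p" "hd p \<in> A \<inter> sym_diff_pair (S, T)"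
    "last p \<in> B \<inter> sym_diff_pair (S, T)"
    "even (path_length p) \<longleftrightarrow> (hd p \<in> S \<longleftrightarrow> last p \<in> S)"
    using linking_imp_induced_path[OF assms(1) ST(1,2) P(2)] .
  have "hd p \<in> S" "last p \<in> S" using ST(3,4) p(2,3) by (auto simp: sym_diff_pair_def)
  with p(1,4) show ?thesis by (auto simp: induced_AB_paths_def)
qed

section \<open>From induced paths to linked pairs\<close>

lemma induced_path_linking:
  assumes p: "induced_AB_path G A B p"
  shows "odd (path_length p) \<Longrightarrow> indep_pairs G A B \<inter> linking G A B \<noteq> {}"
    and "even (path_length p) \<Longrightarrow> indep_pairs G {} (A \<union> B) \<inter> linking G A B \<noteq> {}"
proof -
  \<comment> \<open>The colour classes of the path: \<open>cls True\<close> holds the even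
    positions, hence always the first vertex.\<close>
  define cls where "cls b = {p ! i | i. i < length p \<and> even i = b}" for b
  have ne: "p \<noteq> []" and dist: "distinct p" and V: "set p \<subseteq> verts G"
    and e: "\<And>i. Suc i < length p \<Longrightarrow> {p ! i, p ! Suc i} \<in> edges G"
    and A: "set p \<inter> A = {hd p}" and B: "set p \<inter> B = {last p}"
    and ind: "\<And>i j. i < length p \<Longrightarrow> j < length p \<Longrightarrow>
      {p ! i, p ! j} \<in> edges G \<Longrightarrow> \<bar>int i - int j\<bar> = 1"
    using p by (auto simp: induced_AB_path_def path_def)
  have indep: "independent_set G (cls b)" for b
    unfolding independent_set_def
  proof (intro conjI ballI notI)
    show "cls b \<subseteq> verts G" using V by (auto simp: cls_def)
    fix u v assume "u \<in> cls b" "v \<in> cls b" and uv: "{u, v} \<in> edges G"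
    then obtain i j where "i < length p" "j < length p" "even i = even j" "u = p ! i" "v = p ! j"
      by (auto simp: cls_def)
    with ind uv have "\<bar>int i - int j\<bar> = 1" "even (int i - int j)" by auto
    then show False by (metis even_abs_add_iff odd_one add.right_neutral even_zero dvd_abs_iff)
  qed
  have nth_cls: "p ! i \<in> cls b \<longleftrightarrow> even i = b" if "i < length p" for i b
    using that dist by (auto simp: cls_def nth_eq_iff_index_eq)
  have hd_cls: "hd p \<in> cls b \<longleftrightarrow> b" for b using nth_cls[of 0] ne by (auto simp: hd_conv_nth)
  have last_cls: "last p \<in> cls b \<longleftrightarrow> even (path_length p) = b" for b
    using nth_cls[of "length p - 1"] ne by (auto simp: last_conv_nth path_length_def)
  have sub: "cls b \<subseteq> set p" for b by (auto simp: cls_def)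
  have clsA: "cls b \<inter> A = {}" if "\<not> b" for b
  proof -
    have "cls b \<inter> A \<subseteq> {hd p}" using A sub[of b] by blast
    with hd_cls[of b] that show ?thesis by auto
  qed
  have clsB: "cls b \<inter> B = {}" if "even (path_length p) \<noteq> b" for b
  proof -
    have "cls b \<inter> B \<subseteq> {last p}" using B sub[of b] by blast
    with last_cls[of b] that show ?thesis by auto
  qed
  \<comment> \<open>The classes partition the path, so their symmetric difference is all of it and
    the path itself is the linking walk.\<close>
  have D: "sym_diff_pair (cls b, cls (\<not> b)) = set p" for b
    using nth_cls by (auto simp: sym_diff_pair_def in_set_conv_nth cls_def)
  have "walk_in G (set p) p" using ne e by (auto simp: walk_in_def successively_conv_nth)
  then have "last p \<in> reach G A (set p)" using A by (auto simp: reach_def)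
  then have link: "(cls b, cls (\<not> b)) \<in> linking G A B" for b
    unfolding linking_def mem_Collect_eq D using B by blast
  show "indep_pairs G A B \<inter> linking G A B \<noteq> {}" if "odd (path_length p)"
  proof -
    \<comment> \<open>The first vertex, the only one in \<open>A\<close>, is in
      \<open>cls True\<close>; by odd length the last, the only one in \<open>B\<close>, is in
      \<open>cls False\<close>.\<close>
    have "(cls False, cls True) \<in> indep_pairs G A B"
      using indep clsA[of False] clsB[of True] that by (auto simp: indep_pairs_def)
    with link[of False] show ?thesis by auto
  qed
  show "indep_pairs G {} (A \<union> B) \<inter> linking G A B \<noteq> {}" if "even (path_length p)"
  proof -
    have "(cls True, cls False) \<in> indep_pairs G {} (A \<union> B)"
      using indep clsA[of False] clsB[of False] that by (auto simp: indep_pairs_def Int_Un_distrib)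
    with link[of True] show ?thesis by auto
  qed
qed

section \<open>The exchange on components meeting \<open>A\<close>\<close>

lemma sym_diff_pair_swap_on:
  "W \<subseteq> sym_diff_pair P \<Longrightarrow> sym_diff_pair (swap_on W P) = sym_diff_pair P"
  by (auto simp: sym_diff_pair_def swap_on_def)

lemma swap_on_swap_on: "swap_on W (swap_on W P) = P"
  by (cases P) (auto simp: swap_on_def)

text \<open>A conflict could only be an edge from \<open>S - W\<close> to
  \<open>T \<inter> W\<close>. Its first end is not in \<open>T\<close>, hence in the symmetric
  difference, and closure of \<open>W\<close> under adjacency there would put it in
  \<open>W\<close>.\<close>

lemma independent_swap:
  assumes S: "independent_set G S" and T: "independent_set G T"
    and W: "W = reach G A (sym_diff_pair (S, T))"
  shows "independent_set G ((S - W) \<union> (T \<inter> W))"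
proof -
  have no: "{u, v} \<notin> edges G" if u: "u \<in> S - W" and v: "v \<in> T \<inter> W" for u v
  proof
    assume uv: "{u, v} \<in> edges G"
    show False
    proof (cases "u \<in> T")
      case True
      with uv v T show False by (auto simp: independent_set_def)
    next
      case False
      with u have "u \<in> sym_diff_pair (S, T)" by (simp add: sym_diff_pair_def)
      then have "u \<in> W" using reach_closed[of v G A "sym_diff_pair (S, T)" u] uv v W
        by (simp add: insert_commute)
      with u show False by simp
    qed
  qed
  then have "{v, u} \<notin> edges G" if "u \<in> S - W" "v \<in> T \<inter> W" for u v
    using that by (simp add: insert_commute)
  with no S T show ?thesis by (auto simp: independent_set_def)
qed

lemma sym_diff_pair_commute: "sym_diff_pair (S, T) = sym_diff_pair (T, S)"
  by (auto simp: sym_diff_pair_def)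

definition swap_reach :: "'a graph \<Rightarrow> 'a set \<Rightarrow> 'a set \<times> 'a set \<Rightarrow> 'a set \<times> 'a set" where
  "swap_reach G A P = swap_on (reach G A (sym_diff_pair P)) P"

lemma sym_diff_pair_swap_reach: "sym_diff_pair (swap_reach G A P) = sym_diff_pair P"
  unfolding swap_reach_def by (intro sym_diff_pair_swap_on reach_subset)

text \<open>The exchanged region depends only on the symmetric difference, which the exchange
  preserves; so the second exchange acts on the same region and undoes the first.\<close>

lemma swap_reach_swap_reach: "swap_reach G A (swap_reach G A P) = P"
  unfolding swap_reach_def[of _ _ "swap_reach G A P"] sym_diff_pair_swap_reach
  by (simp add: swap_reach_def swap_on_swap_on)

lemma independent_swap_reach:
  assumes "independent_set G (fst P)" "independent_set G (snd P)"
  shows "independent_set G (fst (swap_reach G A P))" "independent_set G (snd (swap_reach G A P))"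
  using independent_swap[of G "fst P" "snd P" _ A] independent_swap[of G "snd P" "fst P" _ A] assms
  by (simp_all add: swap_reach_def swap_on_def sym_diff_pair_commute[of "snd P" "fst P"])

text \<open>For an unlinked pair, \<open>W\<close> contains all vertices of \<open>A\<close> in the
  symmetric difference and none of \<open>B\<close>. The exchange thus moves the former to the other
  set and leaves the latter in place.\<close>

lemma swap_reach_unlinked:
  assumes "P \<notin> linking G A B"
  shows "P \<in> indep_pairs G A B \<Longrightarrow> swap_reach G A P \<in> indep_pairs G {} (A \<union> B) - linking G A B"
    and "P \<in> indep_pairs G {} (A \<union> B) \<Longrightarrow> swap_reach G A P \<in> indep_pairs G A B - linking G A B"
proof -
  obtain S T where P: "P = (S, T)" by fastforce
  define W where "W = reach G A (sym_diff_pair P)"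
  have W: "W \<inter> B = {}" "W \<subseteq> sym_diff_pair (S, T)" "A \<inter> sym_diff_pair (S, T) \<subseteq> W"
    using assms reach_subset[of G A] subset_reach[of A _ G] by (auto simp: linking_def W_def P)
  have nl: "swap_reach G A P \<notin> linking G A B"
    using assms by (simp add: linking_def sym_diff_pair_swap_reach)
  have eq: "swap_reach G A P = ((S - W) \<union> (T \<inter> W), (T - W) \<union> (S \<inter> W))"
    by (simp add: swap_reach_def swap_on_def W_def P)
  have ind: "independent_set G ((S - W) \<union> (T \<inter> W))" "independent_set G ((T - W) \<union> (S \<inter> W))"
    if "independent_set G S" "independent_set G T"
    using independent_swap_reach[of G P A] that unfolding eq by (simp_all add: P)
  show "swap_reach G A P \<in> indep_pairs G {} (A \<union> B) - linking G A B"
    if "P \<in> indep_pairs G A B"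
  proof -
    have ST: "independent_set G S" "independent_set G T" "S \<inter> A = {}" "T \<inter> B = {}"
      using that by (simp_all add: indep_pairs_def P)
    have "((S - W) \<union> (T \<inter> W)) \<inter> {} = {}" "((T - W) \<union> (S \<inter> W)) \<inter> (A \<union> B) = {}"
      using ST(3,4) W unfolding sym_diff_pair_def fst_conv snd_conv by blast+
    with ind[OF ST(1,2)] nl show ?thesis unfolding eq by (simp add: indep_pairs_def)
  qed
  show "swap_reach G A P \<in> indep_pairs G A B - linking G A B"
    if "P \<in> indep_pairs G {} (A \<union> B)"
  proof -
    have ST: "independent_set G S" "independent_set G T" "S \<inter> {} = {}" "T \<inter> (A \<union> B) = {}"
      using that by (simp_all add: indep_pairs_def P)
    have "((S - W) \<union> (T \<inter> W)) \<inter> A = {}" "((T - W) \<union> (S \<inter> W)) \<inter> B = {}"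
      using ST(3,4) W unfolding sym_diff_pair_def fst_conv snd_conv by blast+
    with ind[OF ST(1,2)] nl show ?thesis unfolding eq by (simp add: indep_pairs_def)
  qed
qed

lemma card_unlinked:
  "card (indep_pairs G A B - linking G A B) = card (indep_pairs G {} (A \<union> B) - linking G A B)"
\<comment> \<open>As an involution, \<open>swap_reach G A\<close> serves both as the bijection and
  as its inverse.\<close>
proof (rule bij_betw_same_card, rule bij_betw_byWitness)
  show "swap_reach G A ` (indep_pairs G A B - linking G A B)
      \<subseteq> indep_pairs G {} (A \<union> B) - linking G A B"
    using swap_reach_unlinked(1) by blast
  show "swap_reach G A ` (indep_pairs G {} (A \<union> B) - linking G A B)
      \<subseteq> indep_pairs G A B - linking G A B"
    using swap_reach_unlinked(2) by blast
qed (simp_all add: swap_reach_swap_reach)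

section \<open>Counting pairs and the sign of \<open>Delta\<close>\<close>

lemma independent_set_delete_verts:
  "independent_set (delete_verts G X) S \<longleftrightarrow> independent_set G S \<and> S \<inter> X = {}"
  by (auto simp: independent_set_def delete_verts_def)

lemma card_indep_pairs:
  "card (indep_pairs G X Y) =
    num_independent_sets (delete_verts G X) * num_independent_sets (delete_verts G Y)"
proof -
  have "indep_pairs G X Y =
    {S. independent_set (delete_verts G X) S} \<times> {T. independent_set (delete_verts G Y) T}"
    by (auto simp: indep_pairs_def independent_set_delete_verts)
  then show ?thesis by (simp add: num_independent_sets_def card_cartesian_product)
qed

lemma finite_indep_pairs:
  assumes "finite (verts G)"
  shows "finite (indep_pairs G X Y)"
proof (rule finite_subset)
  show "indep_pairs G X Y \<subseteq> Pow (verts G) \<times> Pow (verts G)"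
    by (auto simp: indep_pairs_def independent_set_def)
qed (use assms in simp)

text \<open>The unlinked pairs of the two kinds are equinumerous and cancel.\<close>

lemma Delta_eq_linking:
  assumes "finite (verts G)"
  shows "Delta G A B = int (card (indep_pairs G A B \<inter> linking G A B))
    - int (card (indep_pairs G {} (A \<union> B) \<inter> linking G A B))"
proof -
  \<comment> \<open>This makes the product containing \<open>num_independent_sets G\<close> an
    instance of \<open>card_indep_pairs\<close> with \<open>X = {}\<close>.\<close>
  have "delete_verts G {} = G" by (simp add: delete_verts_def)
  then have "Delta G A B = int (card (indep_pairs G A B)) - int (card (indep_pairs G {} (A \<union> B)))"
    by (simp add: Delta_def card_indep_pairs)
  moreover have "card (indep_pairs G X Y) = card (indep_pairs G X Y \<inter> linking G A B)
      + card (indep_pairs G X Y - linking G A B)" for X Y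
    using card_Int_Diff[OF finite_indep_pairs[OF assms]] .
  ultimately show ?thesis using card_unlinked[of G A B] by simp
qed

theorem theorem3p1:
  fixes G :: "'a graph" and A B :: "'a set"
  assumes "finite_simple_graph G"
    and "A \<subseteq> verts G" and "B \<subseteq> verts G"
  shows "(paths_even (induced_AB_paths G A B) \<longrightarrow> Delta G A B < 0) \<and>
         (paths_infinite (induced_AB_paths G A B) \<longrightarrow> Delta G A B = 0) \<and>
         (paths_odd (induced_AB_paths G A B) \<longrightarrow> Delta G A B > 0)"
proof -
  let ?P = "induced_AB_paths G A B"
  let ?L = "indep_pairs G A B \<inter> linking G A B"
  let ?R = "indep_pairs G {} (A \<union> B) \<inter> linking G A B"
  have fin: "finite (verts G)" using assms(1) by (simp add: finite_simple_graph_def)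
  have L: "?L \<noteq> {} \<longleftrightarrow> (\<exists>p\<in>?P. odd (path_length p))"
    using linking_odd[OF assms(1)] induced_path_linking(1)
    by (fastforce simp: induced_AB_paths_def)
  have R: "?R \<noteq> {} \<longleftrightarrow> (\<exists>p\<in>?P. even (path_length p))"
    using linking_even[OF assms(1)] induced_path_linking(2)
    by (fastforce simp: induced_AB_paths_def)
  have "card ?L > 0 \<longleftrightarrow> ?L \<noteq> {}" "card ?R > 0 \<longleftrightarrow> ?R \<noteq> {}"
    using finite_indep_pairs[OF fin] by (simp_all add: card_gt_0_iff)
  then have "card ?L > 0 \<longleftrightarrow> (\<exists>p\<in>?P. odd (path_length p))"
    "card ?R > 0 \<longleftrightarrow> (\<exists>p\<in>?P. even (path_length p))"
    using L R by simp_all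
  \<comment> \<open>If all paths share a parity, exactly one of the two counts is positive and fixes
    the sign; without paths both vanish.\<close>
  then show ?thesis
    unfolding Delta_eq_linking[OF fin] paths_even_def paths_infinite_def paths_odd_def
    by fastforce
qed

end
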